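(* Let $\gamma\in[-\tfrac12,\tfrac12]$, let $\mathcal M_2$ be the algebra of $2\times 2$ complex matrices, and let $\Lambda:\mathcal M_2\to\mathcal M_2$ be the linear map $$\Lambda\begin{bmatrix} r_{11}&r_{12}\\ r_{21}&r_{22}\end{bmatrix}=\begin{bmatrix} r_{11}&2\gamma r_{21}\\ 2\gamma r_{12}&r_{22}\end{bmatrix}.$$ Let $|\phi^+\rangle=\tfrac1{\sqrt2}(|00\rangle+|11\rangle)\in\mathbb C^2\otimes\mathbb C^2$. Then the minimum eigenvalue of the Choi state $(\Lambda\otimes\mathcal I)(|\phi^+\rangle\langle\phi^+|)$ is the minimum, over all two-qubit states $\rho$ on $\mathbb C^2\otimes\mathbb C^2$, of the minimum eigenvalue of $(\Lambda\otimes\mathcal I)(\rho)$; that is, for every two-qubit density matrix $\rho$, $$\lambda_{\min}\big((\Lambda\otimes\mathcal I)(\rho)\big)\ \ge\ \lambda_{\min}\big((\Lambda\otimes\mathcal I)(|\phi^+\rangle\langle\phi^+|)\big).$$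
   Context: $\mathcal I$ denotes the identity map on $\mathcal M_2$. $\lambda_{\min}(H)$ denotes the smallest eigenvalue of a Hermitian matrix $H$. A two-qubit state (density matrix) is a positive semidefinite $4\times4$ matrix of trace one. The Choi state of $\Lambda$ is the matrix obtained by applying $\Lambda\otimes\mathcal I$ to the projector onto the maximally entangled vector $|\phi^+\rangle$. *)

theory Defs
  imports "Jordan_Normal_Form.Spectral_Radius" "Jordan_Normal_Form.Schur_Decomposition"
begin

definition hermitian :: "complex mat \<Rightarrow> bool" where
  "hermitian A \<longleftrightarrow> mat_adjoint A = A"

text \<open>The order on complex numbers is the one of \<open>Complex_Order\<close>: \<open>0 \<le> z\<close> says that \<open>z\<close> is
  real and nonnegative.\<close>

definition positive_semidefinite :: "complex mat \<Rightarrow> bool" where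
  "positive_semidefinite A \<longleftrightarrow>
     hermitian A \<and> (\<forall>v \<in> carrier_vec (dim_row A). 0 \<le> (A *\<^sub>v v) \<bullet>c v)"

definition mat_trace :: "complex mat \<Rightarrow> complex" where
  "mat_trace A = (\<Sum>i<dim_row A. A $$ (i, i))"

text \<open>Only meaningful for Hermitian matrices of positive dimension; for these the minimum is
  taken over a finite nonempty set, see \<open>lambda_min_hermitian\<close>.\<close>

definition lambda_min :: "complex mat \<Rightarrow> real" where
  "lambda_min H = Min {x. complex_of_real x \<in> spectrum H}"

text \<open>Tensor products use the lexicographic order of the product basis: \<open>|a\<rangle> \<otimes> |b\<rangle>\<close> is the basis
  vector with index \<open>n * a + b\<close>, where \<open>n\<close> is the dimension of the second factor.\<close>

definition tensor_vec :: "complex vec \<Rightarrow> complex vec \<Rightarrow> complex vec" where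
  "tensor_vec u v =
     vec (dim_vec u * dim_vec v) (\<lambda>i. u $ (i div dim_vec v) * v $ (i mod dim_vec v))"

definition tensor_mat :: "complex mat \<Rightarrow> complex mat \<Rightarrow> complex mat" where
  "tensor_mat A B =
     mat (dim_row A * dim_row B) (dim_col A * dim_col B)
       (\<lambda>(i, j). A $$ (i div dim_row B, j div dim_col B) * B $$ (i mod dim_row B, j mod dim_col B))"

text \<open>For \<open>X = (\<Sum>k l. X\<^sub>k\<^sub>l \<otimes> |k\<rangle>\<langle>l|)\<close> the matrix \<open>right_block X k l\<close> is the \<open>2 \<times> 2\<close> matrix \<open>X\<^sub>k\<^sub>l\<close>,
  and \<open>tensor_id L X\<close> is \<open>(L \<otimes> \<I>)(X) = (\<Sum>k l. L(X\<^sub>k\<^sub>l) \<otimes> |k\<rangle>\<langle>l|)\<close>. For linear \<open>L\<close> this is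
  the linear extension of \<open>A \<otimes> B \<mapsto> L(A) \<otimes> B\<close>, see \<open>tensor_id_tensor_mat\<close>.\<close>

definition right_block :: "complex mat \<Rightarrow> nat \<Rightarrow> nat \<Rightarrow> complex mat" where
  "right_block X k l = mat 2 2 (\<lambda>(a, b). X $$ (2 * a + k, 2 * b + l))"

definition tensor_id :: "(complex mat \<Rightarrow> complex mat) \<Rightarrow> complex mat \<Rightarrow> complex mat" where
  "tensor_id L X = mat 4 4 (\<lambda>(i, j). L (right_block X (i mod 2) (j mod 2)) $$ (i div 2, j div 2))"

definition two_qubit_state :: "complex mat \<Rightarrow> bool" where
  "two_qubit_state \<rho> \<longleftrightarrow> \<rho> \<in> carrier_mat 4 4 \<and> positive_semidefinite \<rho> \<and> mat_trace \<rho> = 1"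

definition ket :: "nat \<Rightarrow> complex vec" where
  "ket i = unit_vec 2 i"

definition phi_plus :: "complex vec" where
  "phi_plus = complex_of_real (1 / sqrt 2) \<cdot>\<^sub>v
     (tensor_vec (ket 0) (ket 0) + tensor_vec (ket 1) (ket 1))"

definition projector :: "complex vec \<Rightarrow> complex mat" where
  "projector v = mat (dim_vec v) (dim_vec v) (\<lambda>(i, j). v $ i * cnj (v $ j))"

definition choi_state :: "(complex mat \<Rightarrow> complex mat) \<Rightarrow> complex mat" where
  "choi_state L = tensor_id L (projector phi_plus)"

definition Lambda :: "real \<Rightarrow> complex mat \<Rightarrow> complex mat" where
  "Lambda \<gamma> r = mat_of_rows_list 2
     [[r $$ (0, 0), 2 * complex_of_real \<gamma> * r $$ (1, 0)],
      [2 * complex_of_real \<gamma> * r $$ (0, 1), r $$ (1, 1)]]"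


lemma hermitian_iff:
  assumes "A \<in> carrier_mat n n"
  shows "hermitian A \<longleftrightarrow> (\<forall>i<n. \<forall>j<n. A $$ (j, i) = cnj (A $$ (i, j)))"
proof -
  have "mat_adjoint A = mat n n (\<lambda>(i, j). cnj (A $$ (j, i)))"
    using assms by (intro eq_matI) (auto simp: mat_adjoint_def mat_of_rows_def cols_def)
  then have "hermitian A \<longleftrightarrow> (\<forall>j<n. \<forall>i<n. cnj (A $$ (i, j)) = A $$ (j, i))"
    using assms unfolding hermitian_def mat_eq_iff by simp
  then show ?thesis by metis
qed

lemma hermitian_square:
  assumes "hermitian H"
  shows "H \<in> carrier_mat (dim_row H) (dim_row H)"
proof -
  have "dim_row (mat_adjoint H) = dim_col H" by (simp add: mat_adjoint_def)
  with assms show ?thesis by (auto simp: hermitian_def)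
qed

lemma hermitian_eigenvalue_real:
  assumes "hermitian H" and "eigenvalue H k"
  shows "k \<in> \<real>"
proof -
  define n where "n = dim_row H"
  have H: "H \<in> carrier_mat n n" unfolding n_def by (rule hermitian_square[OF assms(1)])
  obtain v where v: "v \<in> carrier_vec n" "v \<noteq> 0\<^sub>v n" "H *\<^sub>v v = k \<cdot>\<^sub>v v"
    using assms(2) by (auto simp: eigenvalue_def eigenvector_def n_def)
  define s where "s = (H *\<^sub>v v) \<bullet>c v"
  have "s = (\<Sum>i<n. (\<Sum>j<n. H $$ (i, j) * v $ j) * cnj (v $ i))"
    unfolding s_def using H v(1) by (simp add: scalar_prod_def lessThan_atLeast0)
  then have s: "s = (\<Sum>i<n. \<Sum>j<n. H $$ (i, j) * v $ j * cnj (v $ i))"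
    by (simp only: sum_distrib_right)
  have "cnj s = (\<Sum>i<n. \<Sum>j<n. cnj (H $$ (i, j)) * cnj (v $ j) * v $ i)"
    unfolding s by simp
  also have "\<dots> = (\<Sum>i<n. \<Sum>j<n. H $$ (j, i) * v $ i * cnj (v $ j))"
    using assms(1) hermitian_iff[OF H]
    by (intro sum.cong refl) (metis (no_types, lifting) lessThan_iff mult.commute mult.assoc)
  also have "\<dots> = s" unfolding s by (rule sum.swap)
  finally have "cnj s = s" .
  then have sr: "s \<in> \<real>" by (simp add: complex_is_Real_iff complex_eq_iff)
  have "s = k * (v \<bullet>c v)" unfolding s_def using v by simp
  moreover have pos: "v \<bullet>c v > 0" using conjugate_square_greater_0_vec[OF v(1)] v(2) by simp
  moreover have "v \<bullet>c v \<in> \<real>" using pos by (simp add: less_complex_def complex_is_Real_iff)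
  ultimately show ?thesis using sr by (metis Reals_divide nonzero_mult_div_cancel_right less_irrefl)
qed

lemma lambda_min_hermitian:
  assumes "hermitian H" and "dim_row H > 0"
  shows "eigenvalue H (complex_of_real (lambda_min H))"
    and "eigenvalue H k \<Longrightarrow> complex_of_real (lambda_min H) \<le> k"
proof -
  let ?S = "{x. complex_of_real x \<in> spectrum H}"
  note H = hermitian_square[OF assms(1)]
  have eq: "spectrum H = complex_of_real ` ?S"
    using hermitian_eigenvalue_real[OF assms(1)] by (auto simp: spectrum_def elim!: Reals_cases)
  have "finite (complex_of_real ` ?S)" using card_finite_spectrum(1)[OF H] eq by simp
  then have fin: "finite ?S" by (rule finite_imageD) (simp add: inj_on_def)
  have "?S \<noteq> {}" using spectrum_non_empty[OF H assms(2)] eq by auto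
  then have "lambda_min H \<in> ?S" unfolding lambda_min_def using fin by (rule Min_in[rotated])
  then show "eigenvalue H (complex_of_real (lambda_min H))" by (simp add: spectrum_def)
  assume "eigenvalue H k"
  then have "k \<in> complex_of_real ` ?S" unfolding eq[symmetric] by (simp add: spectrum_def)
  then show "complex_of_real (lambda_min H) \<le> k"
    unfolding lambda_min_def using fin by (auto simp: less_eq_complex_def)
qed

lemma tensor_id_tensor_mat:
  assumes A: "A \<in> carrier_mat 2 2" and B: "B \<in> carrier_mat 2 2"
    and L: "L A \<in> carrier_mat 2 2" and hom: "\<And>c. L (c \<cdot>\<^sub>m A) = c \<cdot>\<^sub>m L A"
  shows "tensor_id L (tensor_mat A B) = tensor_mat (L A) B"
proof -
  have aux: "2 * a + k < 4" if "a < 2" "k < 2" for a k :: nat using that by linarith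
  have rb: "right_block (tensor_mat A B) k l = B $$ (k, l) \<cdot>\<^sub>m A" if "k < 2" "l < 2" for k l
    using that A B by (intro eq_matI) (auto simp: right_block_def tensor_mat_def aux)
  show ?thesis
    using A B L by (intro eq_matI)
      (auto simp: tensor_id_def rb hom, auto simp: tensor_mat_def)
qed

lemma hermitian_tensor_id_Lambda:
  assumes "\<rho> \<in> carrier_mat 4 4" and "hermitian \<rho>"
  shows "hermitian (tensor_id (Lambda \<gamma>) \<rho>)"
proof -
  have sym: "cnj (\<rho> $$ (i, j)) = \<rho> $$ (j, i)" if "i < 4" "j < 4" for i j
    using assms that hermitian_iff by metis
  have c: "tensor_id (Lambda \<gamma>) \<rho> \<in> carrier_mat 4 4" by (simp add: tensor_id_def)
  have four: "i < 4 \<longleftrightarrow> i = 0 \<or> i = 1 \<or> i = 2 \<or> i = 3" for i :: nat by auto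
  show ?thesis
    unfolding hermitian_iff[OF c]
    by (auto simp: four tensor_id_def Lambda_def right_block_def mat_of_rows_list_def sym)
qed

end

theory Submission
  imports Defs
begin

text \<open>Write a vector of \<open>\<complex>\<^sup>2 \<otimes> \<complex>\<^sup>2\<close> as \<open>v = (x, y)\<close> and a state \<open>\<rho>\<close> in \<open>2 \<times> 2\<close> blocks
  \<open>\<rho>\<^sub>a\<^sub>b\<close>. With \<open>z\<^sub>\<plusminus> = (\<plusminus>y, x)\<close>, the quadratic form of \<open>(\<Lambda> \<otimes> \<I>)(\<rho>)\<close> at \<open>v\<close> is
  \<open>\<langle>x, \<rho>\<^sub>0\<^sub>0 x\<rangle> + \<langle>y, \<rho>\<^sub>1\<^sub>1 y\<rangle> + \<gamma> (\<langle>z\<^sub>+, \<rho> z\<^sub>+\<rangle> - \<langle>z\<^sub>-, \<rho> z\<^sub>-\<rangle>)\<close>. The first two terms are nonnegative and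
  \<open>0 \<le> \<langle>z, \<rho> z\<rangle> \<le> tr \<rho> \<parallel>z\<parallel>\<^sup>2\<close>, so the form is at least \<open>- \<bar>\<gamma>\<bar> \<parallel>v\<parallel>\<^sup>2\<close>. The Choi state is
  diagonal with entries \<open>1/2\<close> on \<open>|00\<rangle>, |11\<rangle>\<close> and swaps \<open>|01\<rangle>, |10\<rangle>\<close> with factor \<open>\<gamma>\<close>, so that
  \<open>- \<bar>\<gamma>\<bar>\<close> is one of its eigenvalues.\<close>

lemma quadratic_form_sum:
  assumes "A \<in> carrier_mat n n" and "v \<in> carrier_vec n"
  shows "(A *\<^sub>v v) \<bullet>c v = (\<Sum>i<n. \<Sum>j<n. A $$ (i, j) * v $ j * cnj (v $ i))"
  using assms by (simp add: scalar_prod_def lessThan_atLeast0 sum_distrib_right)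

lemma positive_semidefiniteD:
  assumes "positive_semidefinite A" and "A \<in> carrier_mat n n" and "v \<in> carrier_vec n"
  shows "0 \<le> Re ((A *\<^sub>v v) \<bullet>c v)"
  using assms by (auto simp: positive_semidefinite_def less_eq_complex_def)

lemma positive_semidefinite_diag_nonneg:
  assumes A: "A \<in> carrier_mat n n" "positive_semidefinite A" and i: "i < n"
  shows "0 \<le> Re (A $$ (i, i))"
proof -
  let ?e = "unit_vec n i :: complex vec"
  have "(A *\<^sub>v ?e) \<bullet>c ?e = (\<Sum>k<n. \<Sum>l<n. A $$ (k, l) * ?e $ l * cnj (?e $ k))"
    using A(1) by (rule quadratic_form_sum) simp
  also have "\<dots> = (\<Sum>k\<in>{i}. \<Sum>l\<in>{i}. A $$ (k, l) * ?e $ l * cnj (?e $ k))"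
    using i by (intro sum.mono_neutral_cong_right sum.mono_neutral_right) auto
  also have "\<dots> = A $$ (i, i)" using i by simp
  finally show ?thesis using positive_semidefiniteD[OF A(2,1), of ?e] by simp
qed

text \<open>Nonnegativity of the form on a vector supported on the coordinates \<open>i\<close> and
  \<open>j\<close> gives the bound. The weights are crossed, \<open>A $$ (i, i)\<close> with
  \<open>b\<close> and \<open>A $$ (j, j)\<close> with \<open>a\<close>, so that the sum over all
  pairs factors into trace times squared norm.\<close>

lemma positive_semidefinite_offdiag_bound:
  assumes A: "A \<in> carrier_mat n n" "positive_semidefinite A" and ij: "i < n" "j < n"
  shows "2 * Re (A $$ (i, j) * b * cnj a) \<le> Re (A $$ (i, i)) * (cmod b)\<^sup>2 + Re (A $$ (j, j)) * (cmod a)\<^sup>2"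
proof (cases "i = j")
  case True
  \<comment> \<open>A single coordinate leaves no room for a two-entry test vector; here the
    diagonal entry is real and nonnegative, and the claim is a multiple of this inequality.\<close>
  have "0 \<le> (cmod (a - b))\<^sup>2" by simp
  then have "2 * Re (b * cnj a) \<le> (cmod b)\<^sup>2 + (cmod a)\<^sup>2"
    unfolding cmod_power2 by (simp add: power2_eq_square algebra_simps)
  then have "Re (A $$ (i, i)) * (2 * Re (b * cnj a)) \<le> Re (A $$ (i, i)) * ((cmod b)\<^sup>2 + (cmod a)\<^sup>2)"
    using positive_semidefinite_diag_nonneg[OF A ij(1)] by (rule mult_left_mono)
  moreover have "Im (A $$ (i, i)) = 0"
    using A ij(1) hermitian_iff[OF A(1)] unfolding positive_semidefinite_def
    by (metis Reals_cnj_iff complex_is_Real_iff)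
  ultimately show ?thesis using True by (simp add: algebra_simps)
next
  case False
  show ?thesis
  proof (cases "a = 0 \<or> b = 0")
    \<comment> \<open>Split off because \<open>sgn 0 = 0\<close>: the test vector below would lose
      the modulus that it must have.\<close>
    case True
    then show ?thesis using positive_semidefinite_diag_nonneg[OF A] ij by auto
  next
    case False
    \<comment> \<open>The moduli of \<open>a\<close> and \<open>b\<close> are exchanged but their
      phases kept, and the minus sign makes the cross term \<open>t * cnj s\<close> equal to
      \<open>- (b * cnj a)\<close>.\<close>
    define s where "s = of_real (cmod b) * sgn a"
    define t where "t = - of_real (cmod a) * sgn b"
    define v where "v = vec n (\<lambda>k. if k = i then s else if k = j then t else 0)"
    have ss: "s * cnj s = of_real ((cmod b)\<^sup>2)" and tt: "t * cnj t = of_real ((cmod a)\<^sup>2)"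
      using False unfolding complex_norm_square[symmetric]
      by (simp_all add: s_def t_def norm_mult norm_sgn)
    have ts: "t * cnj s = - (b * cnj a)"
      using False by (simp add: s_def t_def sgn_div_norm scaleR_conv_of_real field_simps)
    have herm: "A $$ (j, i) = cnj (A $$ (i, j))"
      using A ij hermitian_iff[OF A(1)] unfolding positive_semidefinite_def by blast
    have "(A *\<^sub>v v) \<bullet>c v = (\<Sum>k<n. \<Sum>l<n. A $$ (k, l) * v $ l * cnj (v $ k))"
      using A(1) by (rule quadratic_form_sum) (simp add: v_def)
    also have "\<dots> = (\<Sum>k\<in>{i, j}. \<Sum>l\<in>{i, j}. A $$ (k, l) * v $ l * cnj (v $ k))"
      using ij
      by (intro sum.mono_neutral_cong_right sum.mono_neutral_right) (auto simp: v_def)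
    also have "\<dots> = A $$ (i, i) * (s * cnj s) + A $$ (i, j) * (t * cnj s)
        + cnj (A $$ (i, j) * (t * cnj s)) + A $$ (j, j) * (t * cnj t)"
      using \<open>i \<noteq> j\<close> ij by (simp add: v_def herm algebra_simps)
    finally have q: "(A *\<^sub>v v) \<bullet>c v = \<dots>" .
    have "Re ((A *\<^sub>v v) \<bullet>c v)
        = Re (A $$ (i, i)) * (cmod b)\<^sup>2 - 2 * Re (A $$ (i, j) * b * cnj a)
          + Re (A $$ (j, j)) * (cmod a)\<^sup>2"
      unfolding q ss tt ts by (simp add: algebra_simps del: of_real_power)
    then show ?thesis using positive_semidefiniteD[OF A(2,1), of v] by (simp add: v_def)
  qed
qed

text \<open>Summing the entrywise bound over all \<open>i\<close> and \<open>j\<close> counts trace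
  times squared norm twice, so no diagonalization is involved.\<close>

lemma positive_semidefinite_le_trace:
  assumes A: "A \<in> carrier_mat n n" "positive_semidefinite A" and v: "v \<in> carrier_vec n"
  shows "Re ((A *\<^sub>v v) \<bullet>c v) \<le> Re (mat_trace A) * (\<Sum>i<n. (cmod (v $ i))\<^sup>2)"
proof -
  let ?D = "\<lambda>i. Re (A $$ (i, i))" and ?N = "\<lambda>i. (cmod (v $ i))\<^sup>2"
  have "2 * Re ((A *\<^sub>v v) \<bullet>c v) = (\<Sum>i<n. \<Sum>j<n. 2 * Re (A $$ (i, j) * v $ j * cnj (v $ i)))"
    by (simp only: quadratic_form_sum[OF A(1) v] Re_sum sum_distrib_left)
  also have "\<dots> \<le> (\<Sum>i<n. \<Sum>j<n. ?D i * ?N j + ?D j * ?N i)"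
    using positive_semidefinite_offdiag_bound[OF A] by (intro sum_mono) auto
  also have "\<dots> = 2 * ((\<Sum>i<n. ?D i) * (\<Sum>j<n. ?N j))"
    by (simp add: sum.distrib mult.commute flip: sum_distrib_left sum_distrib_right)
  also have "(\<Sum>i<n. ?D i) = Re (mat_trace A)" using A(1) by (simp add: mat_trace_def)
  finally show ?thesis by simp
qed

text \<open>Off the diagonal blocks the map is the partial transpose on the first factor, scaled by
  \<open>2 * \<gamma>\<close>: the block indices are exchanged, the positions inside the block
  kept.\<close>

lemma tensor_id_Lambda_index:
  assumes "i < 4" and "j < 4"
  shows "tensor_id (Lambda \<gamma>) \<rho> $$ (i, j) =
    (if i div 2 = j div 2 then \<rho> $$ (i, j)
     else 2 * complex_of_real \<gamma> * \<rho> $$ (2 * (j div 2) + i mod 2, 2 * (i div 2) + j mod 2))"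
proof -
  have "i = 0 \<or> i = 1 \<or> i = 2 \<or> i = 3" "j = 0 \<or> j = 1 \<or> j = 2 \<or> j = 3" using assms by auto
  then show ?thesis
    by (elim disjE) (simp_all add: tensor_id_def Lambda_def right_block_def mat_of_rows_list_def
        flip: numeral_2_eq_2)
qed

text \<open>Polarization: in the difference of the forms at \<open>z 1\<close> and
  \<open>z (-1)\<close> the diagonal blocks cancel and the cross terms double, which accounts for
  the factor 2 in \<open>Lambda\<close>.\<close>

lemma tensor_id_Lambda_quadratic_form:
  fixes v :: "complex vec"
  assumes \<rho>: "\<rho> \<in> carrier_mat 4 4" and v: "v \<in> carrier_vec 4"
  defines "x \<equiv> vec 4 (\<lambda>i. if i < 2 then v $ i else 0)"
    and "y \<equiv> vec 4 (\<lambda>i. if i < 2 then 0 else v $ i)"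
    and "z \<equiv> \<lambda>e. vec 4 (\<lambda>i. if i < 2 then e * v $ (i + 2) else v $ (i - 2))"
  shows "(tensor_id (Lambda \<gamma>) \<rho> *\<^sub>v v) \<bullet>c v
    = (\<rho> *\<^sub>v x) \<bullet>c x + (\<rho> *\<^sub>v y) \<bullet>c y
      + complex_of_real \<gamma> * ((\<rho> *\<^sub>v z 1) \<bullet>c z 1 - (\<rho> *\<^sub>v z (-1)) \<bullet>c z (-1))"
proof -
  have T: "tensor_id (Lambda \<gamma>) \<rho> \<in> carrier_mat 4 4" by (simp add: tensor_id_def)
  have x: "x \<in> carrier_vec 4" and y: "y \<in> carrier_vec 4" and z: "z e \<in> carrier_vec 4" for e
    by (auto simp: x_def y_def z_def)
  have four: "(\<Sum>i<4. f i) = f 0 + f 1 + f 2 + f (3::nat)" for f :: "nat \<Rightarrow> complex"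
    by (simp add: eval_nat_numeral)
  show ?thesis
    unfolding quadratic_form_sum[OF T v] quadratic_form_sum[OF \<rho> x] quadratic_form_sum[OF \<rho> y]
      quadratic_form_sum[OF \<rho> z] four
    by (simp add: x_def y_def z_def tensor_id_Lambda_index)
      (simp add: algebra_simps flip: numeral_2_eq_2)
qed

lemma tensor_id_Lambda_lower_bound:
  assumes \<rho>: "two_qubit_state \<rho>" and v: "v \<in> carrier_vec 4"
  shows "- \<bar>\<gamma>\<bar> * (\<Sum>i<4. (cmod (v $ i))\<^sup>2) \<le> Re ((tensor_id (Lambda \<gamma>) \<rho> *\<^sub>v v) \<bullet>c v)"
proof -
  have A: "\<rho> \<in> carrier_mat 4 4" "positive_semidefinite \<rho>" and tr: "mat_trace \<rho> = 1"
    using \<rho> by (auto simp: two_qubit_state_def)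
  define x where "x = vec 4 (\<lambda>i. if i < 2 then v $ i else 0)"
  define y where "y = vec 4 (\<lambda>i. if i < 2 then 0 else v $ i)"
  define z where "z = (\<lambda>e. vec 4 (\<lambda>i. if i < 2 then e * v $ (i + 2) else v $ (i - 2)))"
  define q where "q = (\<lambda>u. Re ((\<rho> *\<^sub>v u) \<bullet>c u))"
  define N where "N = (\<Sum>i<4. (cmod (v $ i))\<^sup>2)"
  have q0: "0 \<le> q u" if "u \<in> carrier_vec 4" for u
    unfolding q_def using A that by (intro positive_semidefiniteD)
  have x: "x \<in> carrier_vec 4" and y: "y \<in> carrier_vec 4" and z: "z e \<in> carrier_vec 4" for e
    by (auto simp: x_def y_def z_def)
  have "(\<Sum>i<4. (cmod (z e $ i))\<^sup>2) = N" if "e = 1 \<or> e = -1" for e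
    using that by (auto simp: z_def N_def eval_nat_numeral norm_mult)
  then have qN: "q (z e) \<le> N" if "e = 1 \<or> e = -1" for e
    using positive_semidefinite_le_trace[OF A z, of e] tr that by (simp add: q_def)
  \<comment> \<open>Both values lie between 0 and \<open>N\<close>; the triangle inequality would
    only give \<open>2 * N\<close>.\<close>
  have "\<bar>q (z 1) - q (z (-1))\<bar> \<le> N"
    using q0[OF z, of 1] q0[OF z, of "-1"] qN[of 1] qN[of "-1"] by simp
  then have "\<bar>\<gamma> * (q (z 1) - q (z (-1)))\<bar> \<le> \<bar>\<gamma>\<bar> * N"
    by (simp add: abs_mult mult_left_mono)
  moreover have "Re ((tensor_id (Lambda \<gamma>) \<rho> *\<^sub>v v) \<bullet>c v)
      = q x + q y + \<gamma> * (q (z 1) - q (z (-1)))"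
    unfolding tensor_id_Lambda_quadratic_form[OF A(1) v] q_def x_def y_def z_def by simp
  ultimately show ?thesis
    using q0[OF x] q0[OF y] unfolding N_def[symmetric] by linarith
qed

text \<open>At an eigenvector for the smallest eigenvalue the form equals that eigenvalue times the
  squared norm \<open>N\<close>, and \<open>N\<close> cancels.\<close>

lemma lambda_min_tensor_id_Lambda_ge:
  assumes "two_qubit_state \<rho>"
  shows "- \<bar>\<gamma>\<bar> \<le> lambda_min (tensor_id (Lambda \<gamma>) \<rho>)"
proof -
  let ?T = "tensor_id (Lambda \<gamma>) \<rho>"
  have "hermitian ?T"
    using assms by (intro hermitian_tensor_id_Lambda)
      (auto simp: two_qubit_state_def positive_semidefinite_def)
  moreover have dim: "dim_row ?T = 4" by (simp add: tensor_id_def)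
  ultimately have "eigenvalue ?T (complex_of_real (lambda_min ?T))"
    by (intro lambda_min_hermitian) auto
  then obtain v where v: "v \<in> carrier_vec 4" "v \<noteq> 0\<^sub>v 4"
      and ev: "?T *\<^sub>v v = complex_of_real (lambda_min ?T) \<cdot>\<^sub>v v"
    by (auto simp: eigenvalue_def eigenvector_def dim)
  define N where "N = (\<Sum>i<4. (cmod (v $ i))\<^sup>2)"
  have vv: "v \<bullet>c v = complex_of_real N"
    using v(1) by (simp add: scalar_prod_def lessThan_atLeast0 N_def flip: complex_norm_square)
  moreover have "0 < v \<bullet>c v" using conjugate_square_greater_0_vec[OF v(1)] v(2) by simp
  ultimately have "0 < N" by (simp add: less_complex_def)
  have "(?T *\<^sub>v v) \<bullet>c v = complex_of_real (lambda_min ?T * N)"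
    unfolding ev using v(1) vv by simp
  then have "- \<bar>\<gamma>\<bar> * N \<le> lambda_min ?T * N"
    using tensor_id_Lambda_lower_bound[OF assms v(1), of \<gamma>] by (simp add: N_def)
  then show ?thesis using \<open>0 < N\<close> by (rule mult_right_le_imp_le)
qed

lemma phi_plus_eq:
  "phi_plus = vec 4 (\<lambda>i. if i \<in> {0, 3} then complex_of_real (1 / sqrt 2) else 0)"
proof (rule eq_vecI)
  fix i assume "i < dim_vec (vec 4 (\<lambda>i. if i \<in> {0, 3} then complex_of_real (1 / sqrt 2) else 0))"
  then have "i = 0 \<or> i = 1 \<or> i = 2 \<or> i = 3" by auto
  then show "phi_plus $ i = vec 4 (\<lambda>i. if i \<in> {0, 3} then complex_of_real (1 / sqrt 2) else 0) $ i"
    by (elim disjE) (simp_all add: phi_plus_def tensor_vec_def ket_def)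
qed (simp add: phi_plus_def tensor_vec_def ket_def)

lemma projector_phi_plus_index:
  assumes "i < 4" "j < 4"
  shows "projector phi_plus $$ (i, j) = (if i \<in> {0, 3} \<and> j \<in> {0, 3} then 1 / 2 else 0)"
proof -
  have "complex_of_real (sqrt 2) * complex_of_real (sqrt 2) = 2"
    by (simp flip: of_real_mult)
  then show ?thesis
    using assms by (auto simp: projector_def phi_plus_eq)
qed

lemma positive_semidefinite_projector: "positive_semidefinite (projector v)"
proof -
  have P: "projector v \<in> carrier_mat (dim_vec v) (dim_vec v)" by (simp add: projector_def)
  have "0 \<le> (projector v *\<^sub>v w) \<bullet>c w" if w: "w \<in> carrier_vec (dim_vec v)" for w
  proof -
    \<comment> \<open>The form of a rank-one projector is the squared modulus of this inner
      product.\<close>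
    define c where "c = (\<Sum>i<dim_vec v. v $ i * cnj (w $ i))"
    have "(projector v *\<^sub>v w) \<bullet>c w = c * cnj c"
      unfolding quadratic_form_sum[OF P w] c_def
      by (simp add: projector_def sum_product mult_ac)
    then show ?thesis by (simp add: less_eq_complex_def)
  qed
  moreover have "hermitian (projector v)"
    unfolding hermitian_iff[OF P] by (simp add: projector_def)
  ultimately show ?thesis using P by (simp add: positive_semidefinite_def)
qed

lemma two_qubit_state_phi_plus: "two_qubit_state (projector phi_plus)"
proof -
  have P: "projector phi_plus \<in> carrier_mat 4 4" by (simp add: projector_def phi_plus_eq)
  then have "mat_trace (projector phi_plus) = (\<Sum>i<4. projector phi_plus $$ (i, i))"
    by (simp add: mat_trace_def)
  also have "\<dots> = (\<Sum>i<4. if i \<in> {0, 3 :: nat} then 1 / 2 else 0)"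
    using projector_phi_plus_index by (intro sum.cong) auto
  also have "\<dots> = 1" by (simp add: eval_nat_numeral)
  finally show ?thesis
    using P positive_semidefinite_projector by (simp add: two_qubit_state_def)
qed

lemma lambda_min_choi_state_Lambda_le: "lambda_min (choi_state (Lambda \<gamma>)) \<le> - \<bar>\<gamma>\<bar>"
proof -
  let ?C = "choi_state (Lambda \<gamma>)"
  \<comment> \<open>The vector |01> + s|10> has eigenvalue \<open>\<gamma> * s\<close> when
    \<open>s\<close> is 1 or -1; the sign is chosen to make this
    \<open>- \<bar>\<gamma>\<bar>\<close>.\<close>
  define s where "s = (if \<gamma> \<ge> 0 then -1 else 1 :: complex)"
  define v where "v = vec 4 (\<lambda>i. if i = 1 then 1 else if i = 2 then s else 0)"
  have C: "?C \<in> carrier_mat 4 4" by (simp add: choi_state_def tensor_id_def)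
  have "hermitian ?C"
    unfolding choi_state_def using two_qubit_state_phi_plus
    by (intro hermitian_tensor_id_Lambda) (auto simp: two_qubit_state_def positive_semidefinite_def)
  have four: "i < 4 \<longleftrightarrow> i = 0 \<or> i = 1 \<or> i = 2 \<or> i = 3" for i :: nat by auto
  have idx: "?C $$ (i, j) = (if i = j \<and> i \<in> {0, 3} then 1 / 2
      else if (i, j) \<in> {(1, 2), (2, 1)} then complex_of_real \<gamma> else 0)" if "i < 4" "j < 4" for i j
    using that unfolding four
    by (elim disjE)
      (simp_all add: choi_state_def tensor_id_Lambda_index projector_phi_plus_index)
  have "?C *\<^sub>v v = complex_of_real (- \<bar>\<gamma>\<bar>) \<cdot>\<^sub>v v"
  proof (rule eq_vecI)
    fix i assume "i < dim_vec (complex_of_real (- \<bar>\<gamma>\<bar>) \<cdot>\<^sub>v v)"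
    then have i: "i < 4" by (simp add: v_def)
    have "(?C *\<^sub>v v) $ i = (\<Sum>j<4. ?C $$ (i, j) * v $ j)"
      using C i by (simp add: scalar_prod_def lessThan_atLeast0 v_def)
    also have "\<dots> = ?C $$ (i, 1) + ?C $$ (i, 2) * s"
      by (simp add: v_def eval_nat_numeral)
    also have "\<dots> = (complex_of_real (- \<bar>\<gamma>\<bar>) \<cdot>\<^sub>v v) $ i"
      using i unfolding four by (auto simp: idx v_def s_def)
    finally show "(?C *\<^sub>v v) $ i = (complex_of_real (- \<bar>\<gamma>\<bar>) \<cdot>\<^sub>v v) $ i" .
  qed (use C in \<open>simp add: v_def\<close>)
  moreover have "v \<in> carrier_vec 4" by (simp add: v_def)
  moreover have "v $ 1 \<noteq> 0\<^sub>v 4 $ 1" by (simp add: v_def)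
  ultimately have "eigenvector ?C v (complex_of_real (- \<bar>\<gamma>\<bar>))"
    using C unfolding eigenvector_def by auto
  then have "eigenvalue ?C (complex_of_real (- \<bar>\<gamma>\<bar>))" unfolding eigenvalue_def by blast
  then have "complex_of_real (lambda_min ?C) \<le> complex_of_real (- \<bar>\<gamma>\<bar>)"
    using \<open>hermitian ?C\<close> C by (intro lambda_min_hermitian(2)) auto
  then show ?thesis by (simp add: less_eq_complex_def)
qed

theorem proposition1:
  fixes \<gamma> :: real
  assumes "\<gamma> \<in> {-1/2..1/2}"
  shows "two_qubit_state (projector phi_plus) \<and>
    (\<forall>\<rho>. two_qubit_state \<rho> \<longrightarrow>
       lambda_min (tensor_id (Lambda \<gamma>) \<rho>) \<ge> lambda_min (choi_state (Lambda \<gamma>)))"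
proof (intro conjI allI impI)
  \<comment> \<open>This makes the Choi value one of the values compared, so the bound is an
    attained minimum.\<close>
  show "two_qubit_state (projector phi_plus)" by (rule two_qubit_state_phi_plus)
  fix \<rho> assume "two_qubit_state \<rho>"
  then show "lambda_min (choi_state (Lambda \<gamma>)) \<le> lambda_min (tensor_id (Lambda \<gamma>) \<rho>)"
    by (rule order_trans[OF lambda_min_choi_state_Lambda_le lambda_min_tensor_id_Lambda_ge])
qed

end
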